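(* Let $\mathcal{S}=\{\mathcal{S}_0,\mathcal{S}_1,\mathcal{S}_2,\mathcal{S}_3\}$ be a finite simplicial complex of dimension $3$, and let $r_i(t)>0$ ($i\in\mathcal{S}_0$), for $t$ in an interval, be a family of nondegenerate metric structures on $\mathcal{S}$ solving the combinatorial Yamabe flow $$\frac{dr_i}{dt}=-K_i r_i\qquad (i\in\mathcal{S}_0),$$ where $K_i$ is the curvature at the vertex $i$. Then for each vertex $i\in\mathcal{S}_0$ the curvature satisfies the evolution equation $$\frac{dK_i}{dt}=\sum_{\{i,j,k,\ell\}\in\mathcal{S}_3}\Big[\Omega_{ijk\ell}(K_j-K_i)+\Omega_{ikj\ell}(K_k-K_i)+\Omega_{i\ell jk}(K_\ell-K_i)\Big],$$ where the sum is over all tetrahedra of $\mathcal{S}$ containing $i$, and where $\Omega_{ijk\ell}=r_j\,\partial\alpha_{ijk\ell}/\partial r_j$ is given explicitly by $$\Omega_{ijk\ell}=\frac{4r_i r_j^2 r_k^2 r_\ell^2}{3P_{ijk}P_{ij\ell}V_{ijk\ell}}\left(\frac1{r_i}\Big(\frac1{r_j}+\frac1{r_k}+\frac1{r_\ell}\Big)+\frac1{r_j}\Big(\frac1{r_i}+\frac1{r_k}+\frac1{r_\ell}\Big)-\Big(\frac1{r_k}-\frac1{r_\ell}\Big)^2\right).$$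
   Context: $\mathcal{S}_0$ is the set of vertices, $\mathcal{S}_1$ the set of edges, and $\mathcal{S}_3$ the set of tetrahedra $\{i,j,k,\ell\}$ of the complex. A metric structure is a function $r:\mathcal{S}_0\to(0,\infty)$; it assigns the length $\ell_{ij}=r_i+r_j$ to each edge $\{i,j\}\in\mathcal{S}_1$. It is nondegenerate if for each $\{i,j,k,\ell\}\in\mathcal{S}_3$ $$Q_{ijk\ell}=\Big(\frac1{r_i}+\frac1{r_j}+\frac1{r_k}+\frac1{r_\ell}\Big)^2-2\Big(\frac1{r_i^2}+\frac1{r_j^2}+\frac1{r_k^2}+\frac1{r_\ell^2}\Big)>0,$$ which is the condition that each tetrahedron is realized as a nondegenerate Euclidean tetrahedron with the prescribed edge lengths. Here $P_{ijk}=2(r_i+r_j+r_k)$ is the perimeter of the triangle $\{i,j,k\}$ and $V_{ijk\ell}$ is the volume of the Euclidean tetrahedron. The dihedral angle of the Euclidean tetrahedron $\{i,j,k,\ell\}$ along the edge $\{i,j\}$ is denoted $\beta_{ijk\ell}$, and the solid angle at $i$ (the area of the spherical triangle cut out on the unit sphere centered at $i$) is $\alpha_{ijk\ell}=\beta_{ijk\ell}+\beta_{ikj\ell}+\beta_{i\ell jk}-\pi$, regarded as a function of $(r_i,r_j,r_k,r_\ell)$. The curvature at the vertex $i$ is $$K_i=4\pi-\sum_{\{i,j,k,\ell\}\in\mathcal{S}_3}\alpha_{ijk\ell},$$ where the sum is over all tetrahedra containing $i$. *)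

theory Defs
  imports "HOL-Analysis.Analysis"
begin

section \<open>Finite abstract simplicial complexes of dimension 3\<close>

definition simplices :: "'v set set \<Rightarrow> nat \<Rightarrow> 'v set set" where
  "simplices S k = {\<sigma> \<in> S. card \<sigma> = k + 1}"

definition finite_complex :: "'v set set \<Rightarrow> bool" where
  "finite_complex S \<longleftrightarrow>
     finite S \<and> (\<forall>\<sigma>\<in>S. finite \<sigma> \<and> \<sigma> \<noteq> {}) \<and>
     (\<forall>\<sigma>\<in>S. \<forall>\<tau>. \<tau> \<subseteq> \<sigma> \<and> \<tau> \<noteq> {} \<longrightarrow> \<tau> \<in> S)"

definition finite_complex_dim3 :: "'v set set \<Rightarrow> bool" where
  "finite_complex_dim3 S \<longleftrightarrow>
     finite_complex S \<and> (\<forall>\<sigma>\<in>S. card \<sigma> \<le> 4) \<and> simplices S 3 \<noteq> {}"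

definition vertices :: "'v set set \<Rightarrow> 'v set" where
  "vertices S = {i. {i} \<in> S}"

section \<open>Metric structures\<close>

definition metric_structure :: "'v set set \<Rightarrow> ('v \<Rightarrow> real) \<Rightarrow> bool" where
  "metric_structure S r \<longleftrightarrow> (\<forall>i\<in>vertices S. r i > 0)"

definition edge_length :: "('v \<Rightarrow> real) \<Rightarrow> 'v \<Rightarrow> 'v \<Rightarrow> real" where
  "edge_length r i j = r i + r j"

definition Q_form :: "('v \<Rightarrow> real) \<Rightarrow> 'v set \<Rightarrow> real" where
  "Q_form r s = (\<Sum>v\<in>s. 1 / r v)\<^sup>2 - 2 * (\<Sum>v\<in>s. 1 / (r v)\<^sup>2)"

definition nondegenerate :: "'v set set \<Rightarrow> ('v \<Rightarrow> real) \<Rightarrow> bool" where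
  "nondegenerate S r \<longleftrightarrow> (\<forall>s\<in>simplices S 3. Q_form r s > 0)"

section \<open>Euclidean tetrahedra\<close>

definition vec_angle :: "'a::real_inner \<Rightarrow> 'a \<Rightarrow> real" where
  "vec_angle u v = arccos (u \<bullet> v / (norm u * norm v))"

definition orth_part :: "'a::real_inner \<Rightarrow> 'a \<Rightarrow> 'a" where
  "orth_part u w = w - (w \<bullet> u / (u \<bullet> u)) *\<^sub>R u"

text \<open>The angle at the edge \<open>ab\<close> between the half-planes bounded by the line \<open>ab\<close>
  through \<open>c\<close> and through \<open>d\<close>.\<close>

definition dihedral_of_points :: "'a::real_inner \<Rightarrow> 'a \<Rightarrow> 'a \<Rightarrow> 'a \<Rightarrow> real" where
  "dihedral_of_points a b c d =
     vec_angle (orth_part (b - a) (c - a)) (orth_part (b - a) (d - a))"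

definition realizes :: "('v \<Rightarrow> real^3) \<Rightarrow> ('v \<Rightarrow> real) \<Rightarrow> 'v set \<Rightarrow> bool" where
  "realizes p r s \<longleftrightarrow>
     (\<forall>u\<in>s. \<forall>v\<in>s. u \<noteq> v \<longrightarrow> dist (p u) (p v) = edge_length r u v)"

text \<open>In the following, \<open>s\<close> is the vertex set of a tetrahedron. The descriptions are
  meaningful where \<open>r\<close> is positive and \<open>Q_form r s > 0\<close>: a realization then exists and is
  unique up to isometry. For \<open>s = {i, j, k, l}\<close>, \<open>dihedral_angle r s i j\<close> is
  \<open>\<beta>\<^sub>i\<^sub>j\<^sub>k\<^sub>l\<close>, \<open>solid_angle r s i\<close> is \<open>\<alpha>\<^sub>i\<^sub>j\<^sub>k\<^sub>l\<close> and
  \<open>Omega r s i j\<close> is \<open>\<Omega>\<^sub>i\<^sub>j\<^sub>k\<^sub>l\<close>; these do not depend on the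
  order of the remaining indices.\<close>

definition dihedral_angle :: "('v \<Rightarrow> real) \<Rightarrow> 'v set \<Rightarrow> 'v \<Rightarrow> 'v \<Rightarrow> real" where
  "dihedral_angle r s i j =
     (THE \<beta>. \<exists>p k l. realizes p r s \<and> s - {i, j} = {k, l} \<and> k \<noteq> l \<and>
        \<beta> = dihedral_of_points (p i) (p j) (p k) (p l))"

definition tetra_volume :: "('v \<Rightarrow> real) \<Rightarrow> 'v set \<Rightarrow> real" where
  "tetra_volume r s =
     (THE V. \<exists>p. realizes p r s \<and> V = measure lebesgue (convex hull (p ` s)))"

definition perimeter :: "('v \<Rightarrow> real) \<Rightarrow> 'v \<Rightarrow> 'v \<Rightarrow> 'v \<Rightarrow> real" where
  "perimeter r i j k = edge_length r i j + edge_length r j k + edge_length r i k"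

definition solid_angle :: "('v \<Rightarrow> real) \<Rightarrow> 'v set \<Rightarrow> 'v \<Rightarrow> real" where
  "solid_angle r s i = (\<Sum>j\<in>s - {i}. dihedral_angle r s i j) - pi"

definition Omega :: "('v \<Rightarrow> real) \<Rightarrow> 'v set \<Rightarrow> 'v \<Rightarrow> 'v \<Rightarrow> real" where
  "Omega r s i j = r j * deriv (\<lambda>x. solid_angle (r(j := x)) s i) (r j)"

section \<open>Curvature and the combinatorial Yamabe flow\<close>

definition curvature :: "'v set set \<Rightarrow> ('v \<Rightarrow> real) \<Rightarrow> 'v \<Rightarrow> real" where
  "curvature S r i = 4 * pi - (\<Sum>s\<in>{s \<in> simplices S 3. i \<in> s}. solid_angle r s i)"

definition yamabe_flow :: "'v set set \<Rightarrow> real set \<Rightarrow> (real \<Rightarrow> 'v \<Rightarrow> real) \<Rightarrow> bool" where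
  "yamabe_flow S T r \<longleftrightarrow>
     (\<forall>t\<in>T. \<forall>i\<in>vertices S.
        ((\<lambda>\<tau>. r \<tau> i) has_real_derivative - curvature S (r t) i * r t i) (at t within T))"

end

theory Submission
  imports Defs
begin

text \<open>In a tetrahedron whose edges have the lengths \<open>r\<^sub>i + r\<^sub>j\<close>, the cosine of every dihedral
  angle is an explicit algebraic function of the radii, and the square roots occurring in its
  derivative combine to the single irrational factor \<open>1 / sqrt D\<close>, where
  \<open>D = (r\<^sub>i r\<^sub>j r\<^sub>k r\<^sub>l)\<^sup>2 Q\<close> and the volume is \<open>sqrt D / 3\<close>. So
  \<open>\<Omega>\<^sub>i\<^sub>j\<^sub>k\<^sub>l = r\<^sub>j \<partial>\<alpha>\<^sub>i / \<partial>r\<^sub>j\<close> reduces to an identity of rational functions.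
  Angles are invariant under scaling, hence the derivative of a solid angle along a curve depends
  only on differences of the logarithmic derivatives of the radii; along the flow
  these logarithmic derivatives are the \<open>-K\<^sub>i\<close>.\<close>

section \<open>The dihedral angle as a function of the radii\<close>

text \<open>\<open>(abcd)\<^sup>2 Q\<close>, cleared of denominators.\<close>

definition disc :: "real \<Rightarrow> real \<Rightarrow> real \<Rightarrow> real \<Rightarrow> real" where
  "disc a b c d = (b*c*d + a*c*d + a*b*d + a*b*c)\<^sup>2
     - 2 * ((b*c*d)\<^sup>2 + (a*c*d)\<^sup>2 + (a*b*d)\<^sup>2 + (a*b*c)\<^sup>2)"

definition dih_num :: "real \<Rightarrow> real \<Rightarrow> real \<Rightarrow> real \<Rightarrow> real" where
  "dih_num a b c d = a*b*(a+b)*(c+d) - c*d*(a\<^sup>2+b\<^sup>2)"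

text \<open>By Heron, a face with radii \<open>a\<close>, \<open>b\<close>, \<open>c\<close> has
  area \<open>sqrt (a*b*c*(a+b+c))\<close>, so the denominator is twice the product of the areas of
  the two faces meeting in the edge.\<close>

definition dih :: "real \<Rightarrow> real \<Rightarrow> real \<Rightarrow> real \<Rightarrow> real" where
  "dih a b c d = arccos (dih_num a b c d / (2*a*b * sqrt (c*d*(a+b+c)*(a+b+d))))"

lemma disc_commute:
  "disc a b c d = disc b a c d" "disc a b c d = disc a c b d" "disc a b c d = disc a b d c"
  by (simp_all add: disc_def algebra_simps)

text \<open>This is \<open>W\<^sup>2 sin\<^sup>2 \<beta>\<close>, where \<open>W\<close> is the denominator of \<open>cos \<beta>\<close> in \<open>dih\<close>.\<close>

lemma dih_num_sq:
  "4*a\<^sup>2*b\<^sup>2*(c*d*(a+b+c)*(a+b+d)) - (dih_num a b c d)\<^sup>2 = (a+b)\<^sup>2 * disc a b c d"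
  unfolding disc_def dih_num_def by algebra

text \<open>Up to the factor \<open>1 / sqrt (disc a b c d)\<close>, these are \<open>b \<partial>\<beta>/\<partial>b\<close> and \<open>c \<partial>\<beta>/\<partial>c\<close> for the
  dihedral angle \<open>\<beta>\<close> at the edge joining the vertices of radii \<open>a\<close> and \<open>b\<close>.\<close>

definition coeff_edge :: "real \<Rightarrow> real \<Rightarrow> real \<Rightarrow> real \<Rightarrow> real" where
  "coeff_edge a b c d = - (a*b\<^sup>2*(c-d)\<^sup>2 + c*d*(b*(a+b)*(2*(a+b)+c+d)
      + 2*(a-b)*((a+b)\<^sup>2 + (a+b)*(c+d) + c*d))) / (2*(a+b+c)*(a+b+d))"

definition coeff_opp :: "real \<Rightarrow> real \<Rightarrow> real \<Rightarrow> real \<Rightarrow> real" where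
  "coeff_opp a b c d = (a+b)*(c*d*(a+b) + a*b*(d-c)) / (2*(a+b+c))"

text \<open>With \<open>x, y, z, w\<close> the logarithmic derivatives of the radii and \<open>W\<close> the denominator of
  \<open>cos \<beta> = N / W\<close>, the left-hand side is \<open>N W' / W - N'\<close>.\<close>

lemma dih_logarithmic_derivative:
  assumes "a > 0" "b > 0" "c > 0" "d > (0::real)"
  shows "dih_num a b c d * (x + y + (z + w + (a*x + b*y + c*z) / (a+b+c) + (a*x + b*y + d*w) / (a+b+d)) / 2)
     - ((a+b)*a*b*(c+d)*(x+y) + a*b*(c+d)*(a*x+b*y) + a*b*(a+b)*(c*z+d*w)
        - c*d*(z+w)*(a\<^sup>2+b\<^sup>2) - 2*c*d*(a\<^sup>2*x + b\<^sup>2*y))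
     = (a+b) * (coeff_edge a b c d * (y - x) + coeff_opp a b c d * (z - x) + coeff_opp a b d c * (w - x))"
proof -
  \<comment> \<open>The semi-perimeters of the two faces at the edge serve as atoms, so that the
    denominators clear; eliminating \<open>c\<close> and \<open>d\<close> then leaves a polynomial
    identity.\<close>
  define P where "P = a+b+c"
  define R where "R = a+b+d"
  have nz: "P \<noteq> 0" "R \<noteq> 0" using assms by (auto simp: P_def R_def)
  have c: "c = P - (a+b)" and d: "d = R - (a+b)" by (auto simp: P_def R_def)
  show ?thesis
    unfolding dih_num_def coeff_edge_def coeff_opp_def P_def[symmetric] R_def[symmetric]
    using nz by (simp add: divide_simps) (unfold c d, algebra)
qed

text \<open>Differentiating arccos divides by \<open>sqrt (1 - (N/W)\<^sup>2)\<close>, which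
  \<open>dih_num_sq\<close> turns into \<open>(a+b) * sqrt disc / W\<close>; the factor
  \<open>a+b\<close> cancels against the one in \<open>dih_logarithmic_derivative\<close>.
  Derivatives are written as value times rate, so that \<open>x\<close>, \<open>y\<close>,
  \<open>z\<close>, \<open>w\<close> are logarithmic derivatives.\<close>

lemma DERIV_dih:
  fixes a b c d :: "real \<Rightarrow> real"
  assumes deriv: "(a has_real_derivative a t * x) (at t within T)"
      "(b has_real_derivative b t * y) (at t within T)"
      "(c has_real_derivative c t * z) (at t within T)"
      "(d has_real_derivative d t * w) (at t within T)"
    and pos: "a t > 0" "b t > 0" "c t > 0" "d t > 0"
    and D: "disc (a t) (b t) (c t) (d t) > 0"
  shows "((\<lambda>\<tau>. dih (a \<tau>) (b \<tau>) (c \<tau>) (d \<tau>)) has_real_derivative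
     (coeff_edge (a t) (b t) (c t) (d t) * (y - x) + coeff_opp (a t) (b t) (c t) (d t) * (z - x)
       + coeff_opp (a t) (b t) (d t) (c t) * (w - x)) / sqrt (disc (a t) (b t) (c t) (d t)))
     (at t within T)"
proof -
  define S where "S = (\<lambda>\<tau>. c \<tau> * d \<tau> * (a \<tau> + b \<tau> + c \<tau>) * (a \<tau> + b \<tau> + d \<tau>))"
  \<comment> \<open>\<open>B\<close> is the logarithmic derivative of \<open>S\<close>, and
    \<open>L\<close> below is that of \<open>W\<close>: each factor of the product contributes one
    summand.\<close>
  define B where "B = z + w + (a t*x + b t*y + c t*z) / (a t+b t+c t)
      + (a t*x + b t*y + d t*w) / (a t+b t+d t)"
  define S' where "S' = S t * B"
  define W where "W = (\<lambda>\<tau>. 2 * a \<tau> * b \<tau> * sqrt (S \<tau>))"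
  define L where "L = x + y + B / 2"
  define N where "N = (\<lambda>\<tau>. dih_num (a \<tau>) (b \<tau>) (c \<tau>) (d \<tau>))"
  define N' where "N' = (a t+b t)*a t*b t*(c t+d t)*(x+y) + a t*b t*(c t+d t)*(a t*x+b t*y)
      + a t*b t*(a t+b t)*(c t*z+d t*w)
        - c t*d t*(z+w)*((a t)\<^sup>2+(b t)\<^sup>2) - 2*c t*d t*((a t)\<^sup>2*x + (b t)\<^sup>2*y)"
  define E where "E = sqrt (disc (a t) (b t) (c t) (d t))"
  have Epos: "E > 0" using D by (simp add: E_def)
  have Spos: "S t > 0" using pos by (simp add: S_def)
  have Wpos: "W t > 0" using pos Spos by (simp add: W_def)
  have nz: "a t + b t + c t \<noteq> 0" "a t + b t + d t \<noteq> 0" using pos by auto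
  have "S' = c t * d t * (a t+b t+c t) * (a t+b t+d t) * (z + w)
      + c t * d t * (a t+b t+d t) * (a t*x + b t*y + c t*z)
      + c t * d t * (a t+b t+c t) * (a t*x + b t*y + d t*w)"
  proof -
    have "k * P * R * (v + p / P + q / R) = k * P * R * v + k * R * p + k * P * q"
      if "P \<noteq> 0" "R \<noteq> 0" for k P R v p q :: real
      using that by (simp add: field_simps)
    from this[OF nz] show ?thesis
      unfolding S'_def S_def B_def .
  qed
  then have dS: "(S has_real_derivative S') (at t within T)"
    unfolding S_def
    by (auto intro!: derivative_eq_intros deriv simp: algebra_simps)
  have "((\<lambda>\<tau>. sqrt (S \<tau>)) has_real_derivative inverse (sqrt (S t)) / 2 * S') (at t within T)"
    by (rule DERIV_chain2[OF DERIV_real_sqrt[OF Spos] dS])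
  also have "inverse (sqrt (S t)) / 2 * S' = sqrt (S t) * (L - x - y)"
  proof -
    have "S' = (sqrt (S t))\<^sup>2 * (2 * (L - x - y))"
      using Spos by (simp add: S'_def L_def)
    moreover have "inverse q / 2 * (q\<^sup>2 * (2 * m)) = q * m" if "q \<noteq> 0" for q m :: real
      using that by (simp add: power2_eq_square field_simps)
    ultimately show ?thesis
      using Spos by (metis real_sqrt_eq_zero_cancel_iff less_irrefl)
  qed
  finally have dR: "((\<lambda>\<tau>. sqrt (S \<tau>)) has_real_derivative sqrt (S t) * (L - x - y)) (at t within T)" .
  have dW: "(W has_real_derivative W t * L) (at t within T)"
    unfolding W_def
    by (rule DERIV_cong[OF DERIV_mult[OF DERIV_mult[OF DERIV_cmult[OF deriv(1)] deriv(2)] dR]])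
      (simp add: algebra_simps)
  have dN: "(N has_real_derivative N') (at t within T)"
    unfolding N_def dih_num_def N'_def
    by (auto intro!: derivative_eq_intros deriv simp: algebra_simps power2_eq_square)
  have sq: "(W t)\<^sup>2 - (N t)\<^sup>2 = ((a t + b t) * E)\<^sup>2"
    using dih_num_sq[of "a t" "b t" "c t" "d t"] Spos D
    by (simp add: W_def N_def power_mult_distrib E_def S_def)
  have quot: "((\<lambda>\<tau>. N \<tau> / W \<tau>) has_real_derivative (N' - N t * L) / W t) (at t within T)"
    using Wpos by (auto intro!: derivative_eq_intros dN dW simp: field_simps)
  have aE: "(a t + b t) * E > 0" using pos Epos by simp
  have "1 - (N t / W t)\<^sup>2 = ((W t)\<^sup>2 - (N t)\<^sup>2) / (W t)\<^sup>2"
    using Wpos by (simp add: power_divide diff_divide_distrib)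
  also have "\<dots> = ((a t + b t) * E / W t)\<^sup>2"
    unfolding sq power_divide ..
  finally have sin_sq: "1 - (N t / W t)\<^sup>2 = ((a t + b t) * E / W t)\<^sup>2" .
  have root: "sqrt (1 - (N t / W t)\<^sup>2) = (a t + b t) * E / W t"
    unfolding sin_sq using aE Wpos by simp
  \<comment> \<open>Positivity of \<open>disc\<close> keeps the cosine strictly between -1 and 1,
    where arccos is differentiable.\<close>
  have "1 - (N t / W t)\<^sup>2 > 0"
    unfolding sin_sq using aE Wpos by (intro zero_less_power divide_pos_pos)
  then have "\<bar>N t / W t\<bar> < 1"
    by (simp add: abs_square_less_1)
  then have "-1 < N t / W t" "N t / W t < 1" by linarith+
  then have "((\<lambda>\<tau>. arccos (N \<tau> / W \<tau>)) has_real_derivative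
      inverse (- sqrt (1 - (N t / W t)\<^sup>2)) * ((N' - N t * L) / W t)) (at t within T)"
    by (intro DERIV_chain2[OF DERIV_arccos quot])
  also have "inverse (- sqrt (1 - (N t / W t)\<^sup>2)) * ((N' - N t * L) / W t)
      = (N t * L - N') / ((a t + b t) * E)"
    unfolding root using aE Wpos by (simp add: divide_simps)
  also have "N t * L - N' = (a t + b t) * (coeff_edge (a t) (b t) (c t) (d t) * (y - x)
     + coeff_opp (a t) (b t) (c t) (d t) * (z - x) + coeff_opp (a t) (b t) (d t) (c t) * (w - x))"
    unfolding N_def L_def B_def N'_def using dih_logarithmic_derivative[OF pos] by simp
  finally show ?thesis
    using pos unfolding dih_def N_def W_def S_def E_def by simp
qed

text \<open>The explicit formula for \<Omega> after inserting the perimeters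
  \<open>2*(a+b+c)\<close> and \<open>2*(a+b+d)\<close> and the volume \<open>sqrt disc / 3\<close>,
  which cancels its constant 4/3.\<close>

definition omega :: "real \<Rightarrow> real \<Rightarrow> real \<Rightarrow> real \<Rightarrow> real" where
  "omega a b c d = a*b\<^sup>2*c\<^sup>2*d\<^sup>2 / ((a+b+c)*(a+b+d) * sqrt (disc a b c d))
     * (1/a*(1/b+1/c+1/d) + 1/b*(1/a+1/c+1/d) - (1/c-1/d)\<^sup>2)"

text \<open>The left-hand side collects the coefficients of \<open>y - x\<close> over the three
  edges at the vertex of radius \<open>a\<close>: the vertex of radius \<open>b\<close> is an
  endpoint of the first edge and opposite to the other two.\<close>

lemma omega_eq_coeffs:
  assumes "a > 0" "b > 0" "c > 0" "d > (0::real)" "disc a b c d > 0"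
  shows "coeff_edge a b c d + coeff_opp a c b d + coeff_opp a d b c
    = omega a b c d * sqrt (disc a b c d)"
proof -
  define P where "P = a+b+c"
  define R where "R = a+b+d"
  have nz: "P \<noteq> 0" "R \<noteq> 0" "a \<noteq> 0" "b \<noteq> 0" "c \<noteq> 0" "d \<noteq> 0" using assms by (auto simp: P_def R_def)
  \<comment> \<open>The two \<open>coeff_opp\<close> terms carry the same semi-perimeters with the
    summands in another order.\<close>
  have comm: "a+c+b = P" "a+d+b = R" by (auto simp: P_def R_def)
  have "omega a b c d * sqrt (disc a b c d) =
     (a*b\<^sup>2*c\<^sup>2*d\<^sup>2 * (1/a*(1/b+1/c+1/d) + 1/b*(1/a+1/c+1/d) - (1/c-1/d)\<^sup>2)) / (P * R)"
    using assms unfolding omega_def P_def R_def by simp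
  also have "a*b\<^sup>2*c\<^sup>2*d\<^sup>2 * (1/a*(1/b+1/c+1/d) + 1/b*(1/a+1/c+1/d) - (1/c-1/d)\<^sup>2)
      = b*c*d*(c*d + b*d + b*c) + b*c*d*(c*d + a*d + a*c) - a*b\<^sup>2*(c-d)\<^sup>2"
    using nz by (simp add: field_simps power2_eq_square)
  finally show ?thesis
    unfolding coeff_edge_def coeff_opp_def comm P_def[symmetric] R_def[symmetric]
    using nz(1,2) by (simp add: divide_simps) (unfold P_def R_def, algebra)
qed

text \<open>Three instances of \<open>DERIV_dih\<close> with the roles of \<open>b\<close>,
  \<open>c\<close>, \<open>d\<close> permuted. By the symmetry of \<open>disc\<close> they share one
  root, and collecting the differences gives the sums in \<open>omega_eq_coeffs\<close>.\<close>

lemma DERIV_dih_sum: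
  fixes a b c d :: "real \<Rightarrow> real"
  assumes deriv: "(a has_real_derivative a t * x) (at t within T)"
      "(b has_real_derivative b t * y) (at t within T)"
      "(c has_real_derivative c t * z) (at t within T)"
      "(d has_real_derivative d t * w) (at t within T)"
    and pos: "a t > 0" "b t > 0" "c t > 0" "d t > 0"
    and D: "disc (a t) (b t) (c t) (d t) > 0"
  shows "((\<lambda>\<tau>. dih (a \<tau>) (b \<tau>) (c \<tau>) (d \<tau>) + dih (a \<tau>) (c \<tau>) (b \<tau>) (d \<tau>)
       + dih (a \<tau>) (d \<tau>) (b \<tau>) (c \<tau>)) has_real_derivative
     omega (a t) (b t) (c t) (d t) * (y - x) + omega (a t) (c t) (b t) (d t) * (z - x)
       + omega (a t) (d t) (b t) (c t) * (w - x)) (at t within T)"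
proof -
  define E where "E = sqrt (disc (a t) (b t) (c t) (d t))"
  have Epos: "E > 0" using D by (simp add: E_def)
  have D2: "disc (a t) (c t) (b t) (d t) = disc (a t) (b t) (c t) (d t)"
    "disc (a t) (d t) (b t) (c t) = disc (a t) (b t) (c t) (d t)"
    by (metis disc_commute)+
  note 1 = DERIV_dih[OF deriv pos D]
  have 2: "((\<lambda>\<tau>. dih (a \<tau>) (c \<tau>) (b \<tau>) (d \<tau>)) has_real_derivative
     (coeff_edge (a t) (c t) (b t) (d t) * (z - x) + coeff_opp (a t) (c t) (b t) (d t) * (y - x)
       + coeff_opp (a t) (c t) (d t) (b t) * (w - x)) / E) (at t within T)"
    using DERIV_dih[OF deriv(1,3,2,4) pos(1,3,2,4)] D D2 by (simp add: E_def)
  have 3: "((\<lambda>\<tau>. dih (a \<tau>) (d \<tau>) (b \<tau>) (c \<tau>)) has_real_derivative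
     (coeff_edge (a t) (d t) (b t) (c t) * (w - x) + coeff_opp (a t) (d t) (b t) (c t) * (y - x)
       + coeff_opp (a t) (d t) (c t) (b t) * (z - x)) / E) (at t within T)"
    using DERIV_dih[OF deriv(1,4,2,3) pos(1,4,2,3)] D D2 by (simp add: E_def)
  have o1: "omega (a t) (b t) (c t) (d t) = (coeff_edge (a t) (b t) (c t) (d t)
      + coeff_opp (a t) (c t) (b t) (d t) + coeff_opp (a t) (d t) (b t) (c t)) / E"
    using omega_eq_coeffs[OF pos D] Epos by (simp add: E_def)
  have o2: "omega (a t) (c t) (b t) (d t) = (coeff_edge (a t) (c t) (b t) (d t)
      + coeff_opp (a t) (b t) (c t) (d t) + coeff_opp (a t) (d t) (c t) (b t)) / E"
    using omega_eq_coeffs[OF pos(1,3,2,4)] D D2 Epos by (simp add: E_def)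
  have o3: "omega (a t) (d t) (b t) (c t) = (coeff_edge (a t) (d t) (b t) (c t)
      + coeff_opp (a t) (b t) (d t) (c t) + coeff_opp (a t) (c t) (d t) (b t)) / E"
    using omega_eq_coeffs[OF pos(1,4,2,3)] D D2 Epos by (simp add: E_def)
  show ?thesis
    unfolding o1 o2 o3
    by (rule DERIV_cong[OF DERIV_add[OF DERIV_add[OF 1[folded E_def] 2] 3]])
      (use Epos in \<open>simp add: field_simps\<close>)
qed

section \<open>Euclidean tetrahedra with edge lengths given by radii\<close>

lemma inner_of_side_lengths:
  fixes x y z :: "'a::real_inner"
  shows "(y - x) \<bullet> (z - x) = ((dist x y)\<^sup>2 + (dist x z)\<^sup>2 - (dist y z)\<^sup>2) / 2"
  by (simp add: dist_norm power2_norm_eq_inner inner_diff_left inner_diff_right inner_commute)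

lemma dihedral_of_points_commute: "dihedral_of_points x y z w = dihedral_of_points x y w z"
  by (simp add: dihedral_of_points_def vec_angle_def inner_commute mult.commute)

text \<open>Expressed by Gram entries, the projections depend on the side lengths alone.\<close>

lemma inner_orth_part:
  assumes "u \<noteq> 0"
  shows "orth_part u v \<bullet> orth_part u w = ((u \<bullet> u) * (v \<bullet> w) - (u \<bullet> v) * (u \<bullet> w)) / (u \<bullet> u)"
  using assms by (simp add: orth_part_def inner_diff_left inner_diff_right inner_commute field_simps)

lemma edge_inner_products:
  fixes x y z w :: "'a::real_inner"
  assumes "dist x y = a + b" "dist x z = a + c" "dist x w = a + d"
      "dist y z = b + c" "dist y w = b + d" "dist z w = c + d"
  shows "(y - x) \<bullet> (y - x) = (a+b)\<^sup>2" "(z - x) \<bullet> (z - x) = (a+c)\<^sup>2"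
    "(w - x) \<bullet> (w - x) = (a+d)\<^sup>2"
    "(y - x) \<bullet> (z - x) = a\<^sup>2 + a*b + a*c - b*c" "(y - x) \<bullet> (w - x) = a\<^sup>2 + a*b + a*d - b*d"
    "(z - x) \<bullet> (w - x) = a\<^sup>2 + a*c + a*d - c*d"
  unfolding inner_of_side_lengths assms by (simp_all add: power2_eq_square field_simps)

lemma dihedral_of_points_eq_dih:
  fixes x y z w :: "'a::real_inner"
  assumes pos: "a > 0" "b > 0" "c > 0" "d > 0"
    and dist: "dist x y = a + b" "dist x z = a + c" "dist x w = a + d"
      "dist y z = b + c" "dist y w = b + d" "dist z w = c + d"
  shows "dihedral_of_points x y z w = dih a b c d"
proof -
  define u v t where "u = y - x" and "v = z - x" and "t = w - x"
  note ip = edge_inner_products[OF dist, folded u_def v_def t_def]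
  have "u \<noteq> 0" using ip(1) pos by auto
  note orth = inner_orth_part[OF this]
  have s: "(a+b)\<^sup>2 > 0" using pos by simp
  \<comment> \<open>The height of a face over the edge: twice its Heron area divided by the edge
    length \<open>a+b\<close>.\<close>
  have n1: "norm (orth_part u v) = sqrt (4*a*b*c*(a+b+c) / (a+b)\<^sup>2)"
    unfolding norm_eq_sqrt_inner orth ip
    by (rule arg_cong[of _ _ sqrt], rule arg_cong2[of _ _ _ _ divide]) (algebra | rule refl)+
  have n2: "norm (orth_part u t) = sqrt (4*a*b*d*(a+b+d) / (a+b)\<^sup>2)"
    unfolding norm_eq_sqrt_inner orth ip
    by (rule arg_cong[of _ _ sqrt], rule arg_cong2[of _ _ _ _ divide]) (algebra | rule refl)+
  have "norm (orth_part u v) * norm (orth_part u t)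
      = sqrt (((4*a*b)\<^sup>2 * (c*d*(a+b+c)*(a+b+d))) / ((a+b)\<^sup>2)\<^sup>2)"
    unfolding n1 n2 real_sqrt_mult[symmetric] times_divide_times_eq power2_eq_square
    by (simp only: mult_ac)
  also have "\<dots> = 4*a*b * sqrt (c*d*(a+b+c)*(a+b+d)) / (a+b)\<^sup>2"
    unfolding real_sqrt_divide real_sqrt_mult real_sqrt_abs using pos by simp
  finally have nn: "norm (orth_part u v) * norm (orth_part u t)
      = 4*a*b * sqrt (c*d*(a+b+c)*(a+b+d)) / (a+b)\<^sup>2" .
  have "orth_part u v \<bullet> orth_part u t = 2 * dih_num a b c d / (a+b)\<^sup>2"
    unfolding orth ip dih_num_def
    by (rule arg_cong2[of _ _ _ _ divide]) (algebra | rule refl)+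
  with nn have "orth_part u v \<bullet> orth_part u t / (norm (orth_part u v) * norm (orth_part u t))
     = 2 * dih_num a b c d / (4*a*b * sqrt (c*d*(a+b+c)*(a+b+d)))"
    using s by simp
  also have "\<dots> = dih_num a b c d / (2*a*b * sqrt (c*d*(a+b+c)*(a+b+d)))"
    by simp
  finally show ?thesis
    by (simp add: dihedral_of_points_def vec_angle_def dih_def u_def v_def t_def)
qed

section \<open>Volume and existence of a tetrahedron with prescribed radii\<close>

lemma content_tetrahedron:
  fixes x y z w :: "real^3"
  assumes "distinct [x, y, z, w]"
  shows "measure lebesgue (convex hull {x, y, z, w})
    = \<bar>det (\<chi> m n. (if n = 1 then y - x else if n = 2 then z - x else w - x) $ m)\<bar> / 6"
proof -
  \<comment> \<open>\<open>content_simplex\<close> wants the vertices other than the base point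
    \<open>x\<close> enumerated by the index type.\<close>
  define f :: "3 \<Rightarrow> real^3" where "f n = (if n = 1 then y else if n = 2 then z else w)" for n
  have "bij_betw f UNIV ({x, y, z, w} - {x})"
    using assms unfolding bij_betw_def UNIV_3 f_def by (auto simp: inj_on_def)
  moreover have "card {x, y, z, w} = Suc CARD(3)" using assms by simp
  ultimately have "measure lborel (convex hull {x, y, z, w})
      = \<bar>det (\<chi> m n. f n $ m - x $ m)\<bar> / fact CARD(3)"
    by (intro content_simplex) auto
  moreover have "(\<chi> m n. f n $ m - x $ m)
      = (\<chi> m n. (if n = 1 then y - x else if n = 2 then z - x else w - x) $ m)"
    by (simp add: f_def vec_eq_iff)
  \<comment> \<open>The hull is compact, hence Borel, so completing the measure does not change its
    value.\<close>
  moreover have "convex hull {x, y, z, w} \<in> sets lborel"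
    by (simp add: finite_imp_compact_convex_hull borel_compact)
  ultimately show ?thesis
    by (simp add: measure_completion fact_numeral)
qed

text \<open>The squared determinant of the edge vectors is their Gram determinant, which equals
  \<open>4 * disc\<close>; a sixth of its root is the volume.\<close>

lemma content_eq_sqrt_disc:
  fixes x y z w :: "real^3"
  assumes pos: "a > 0" "b > 0" "c > 0" "d > 0"
    and dist: "dist x y = a + b" "dist x z = a + c" "dist x w = a + d"
      "dist y z = b + c" "dist y w = b + d" "dist z w = c + d"
  shows "measure lebesgue (convex hull {x, y, z, w}) = sqrt (disc a b c d) / 3"
proof -
  define u v t where "u = y - x" and "v = z - x" and "t = w - x"
  note ip = edge_inner_products[OF dist, folded u_def v_def t_def]
  define M :: "real^3^3" where "M = (\<chi> m n::3. (if n = 1 then u else if n = 2 then v else t) $ m)"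
  have "(det M)\<^sup>2 = (u \<bullet> u) * (v \<bullet> v) * (t \<bullet> t) + 2 * (u \<bullet> v) * (v \<bullet> t) * (u \<bullet> t)
      - (u \<bullet> u) * (v \<bullet> t)\<^sup>2 - (v \<bullet> v) * (u \<bullet> t)\<^sup>2 - (t \<bullet> t) * (u \<bullet> v)\<^sup>2"
    unfolding M_def det_3 inner_vec_def sum_3 inner_real_def by simp algebra
  also have "\<dots> = 4 * disc a b c d"
    unfolding ip disc_def by algebra
  finally have "\<bar>det M\<bar> = 2 * sqrt (disc a b c d)"
    by (metis real_sqrt_abs real_sqrt_four real_sqrt_mult)
  moreover have "distinct [x, y, z, w]"
    using dist pos by auto
  ultimately show ?thesis
    unfolding M_def u_def v_def t_def by (simp add: content_tetrahedron)
qed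

text \<open>Place \<open>x\<close> at the origin, \<open>y\<close> on the first axis and
  \<open>z\<close> in the plane of the first two. With \<open>e\<close> the area of that face, the
  fourth vertex has height \<open>sqrt disc / e\<close>, real because \<open>disc\<close> is
  nonnegative.\<close>

lemma tetrahedron_exists:
  assumes pos: "a > 0" "b > 0" "c > 0" "d > 0" and D: "disc a b c d \<ge> 0"
  obtains x y z w :: "real^3" where
    "dist x y = a + b" "dist x z = a + c" "dist x w = a + d"
    "dist y z = b + c" "dist y w = b + d" "dist z w = c + d"
proof -
  define s where "s = a + b"
  define e where "e = sqrt (a*b*c*(a+b+c))"
  define g where "g = a\<^sup>2 + a*b + a*c - b*c"
  define m where "m = a\<^sup>2 + a*b + a*d - b*d"
  define N where "N = dih_num a b c d"
  define q where "q = sqrt (disc a b c d)"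
  \<comment> \<open>the Cholesky factor of the Gram matrix of the three edge vectors at \<open>x\<close>\<close>
  define u v t :: "real^3" where "u = vector [s, 0, 0]" and "v = vector [g/s, 2*e/s, 0]"
    and "t = vector [m/s, N/(s*e), q/e]"
  have s: "s > 0" and e: "e > 0" using pos by (auto simp: s_def e_def)
  have e2: "e\<^sup>2 = a*b*c*(a+b+c)" using pos by (simp add: e_def)
  have q2: "q\<^sup>2 = disc a b c d" using D by (simp add: q_def)
  have uu: "u \<bullet> u = s\<^sup>2" and uv: "u \<bullet> v = g" and ut: "u \<bullet> t = m"
    using s by (simp_all add: u_def v_def t_def inner_vec_def sum_3 power2_eq_square)
  have "v \<bullet> v = (g\<^sup>2 + 4*e\<^sup>2) / s\<^sup>2"
    using s by (simp add: v_def inner_vec_def sum_3 power2_eq_square add_divide_distrib)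
  also have "g\<^sup>2 + 4*e\<^sup>2 = (a+c)\<^sup>2 * s\<^sup>2"
    unfolding e2 g_def s_def by algebra
  finally have vv: "v \<bullet> v = (a+c)\<^sup>2" using s by simp
  have "v \<bullet> t = (g*m + 2*N) / s\<^sup>2"
    using s e by (simp add: v_def t_def inner_vec_def sum_3 power2_eq_square add_divide_distrib)
  also have "g*m + 2*N = (a\<^sup>2 + a*c + a*d - c*d) * s\<^sup>2"
    unfolding g_def m_def N_def dih_num_def s_def by algebra
  finally have vt: "v \<bullet> t = a\<^sup>2 + a*c + a*d - c*d" using s by simp
  have "t \<bullet> t = (m\<^sup>2 * e\<^sup>2 + (N\<^sup>2 + s\<^sup>2 * q\<^sup>2)) / (s\<^sup>2 * e\<^sup>2)"
    using s e by (simp add: t_def inner_vec_def sum_3 power2_eq_square field_simps)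
  \<comment> \<open>The height coordinate enters only through \<open>q\<^sup>2\<close>, so
    \<open>dih_num_sq\<close> applies and makes \<open>e\<^sup>2\<close> a common factor.\<close>
  also have "N\<^sup>2 + s\<^sup>2 * q\<^sup>2 = 4*a\<^sup>2*b\<^sup>2*(c*d*(a+b+c)*(a+b+d))"
    using dih_num_sq[of a b c d] unfolding N_def q2 s_def by simp
  also have "\<dots> = 4*a*b*d*(a+b+d) * e\<^sup>2"
    unfolding e2 by algebra
  also have "m\<^sup>2 * e\<^sup>2 + \<dots> = (a+d)\<^sup>2 * (s\<^sup>2 * e\<^sup>2)"
    unfolding m_def s_def by algebra
  finally have tt: "t \<bullet> t = (a+d)\<^sup>2" using s e by simp
  have dist: "dist p p' = r" if "p \<bullet> p - 2 * (p \<bullet> p') + p' \<bullet> p' = r\<^sup>2" "r > 0" for p p' :: "real^3" and r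
    using that unfolding dist_norm norm_eq_sqrt_inner
    by (simp add: inner_diff_left inner_diff_right inner_commute algebra_simps real_sqrt_unique)
  show thesis
  proof (rule that)
    show "dist 0 u = a + b" by (rule dist) (use pos uu in \<open>auto simp: s_def\<close>)
    show "dist 0 v = a + c" by (rule dist) (use pos vv in auto)
    show "dist 0 t = a + d" by (rule dist) (use pos tt in auto)
    show "dist u v = b + c" "dist u t = b + d" "dist v t = c + d"
      using pos by (auto intro!: dist simp: uu vv tt uv ut vt s_def g_def m_def power2_eq_square algebra_simps)
  qed
qed

section \<open>Angles and volume of a metric structure\<close>

lemma Q_form_pos_iff:
  assumes "distinct [i, j, k, l]" "r i > 0" "r j > 0" "r k > 0" "r l > 0"
  shows "Q_form r {i, j, k, l} > 0 \<longleftrightarrow> disc (r i) (r j) (r k) (r l) > 0"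
proof -
  have "disc (r i) (r j) (r k) (r l) = (r i * r j * r k * r l)\<^sup>2 * Q_form r {i, j, k, l}"
    using assms
    by (simp add: Q_form_def disc_def add.assoc[symmetric]) (simp add: field_simps power2_eq_square)
  then show ?thesis
    using assms by (simp add: zero_less_mult_iff)
qed

lemma realizes_insert4:
  assumes "distinct [i, j, k, l]"
  shows "realizes p r {i, j, k, l} \<longleftrightarrow>
     dist (p i) (p j) = r i + r j \<and> dist (p i) (p k) = r i + r k \<and> dist (p i) (p l) = r i + r l \<and>
     dist (p j) (p k) = r j + r k \<and> dist (p j) (p l) = r j + r l \<and> dist (p k) (p l) = r k + r l"
  using assms unfolding realizes_def edge_length_def
  by (auto simp: dist_commute add.commute)

lemma realizes_exists:
  assumes "distinct [i, j, k, l]" "r i > 0" "r j > 0" "r k > 0" "r l > 0"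
    and "disc (r i) (r j) (r k) (r l) > 0"
  obtains p where "realizes p r {i, j, k, l}"
proof -
  obtain x y z w :: "real^3" where *: "dist x y = r i + r j" "dist x z = r i + r k"
    "dist x w = r i + r l" "dist y z = r j + r k" "dist y w = r j + r l" "dist z w = r k + r l"
    using tetrahedron_exists[OF assms(2-5) less_imp_le[OF assms(6)]] by blast
  \<comment> \<open>The default value \<open>x\<close> serves as the image of \<open>i\<close>; the
    updates place the other three vertices.\<close>
  have "realizes ((\<lambda>_. x)(j := y, k := z, l := w)) r {i, j, k, l}"
    using assms(1) * by (subst realizes_insert4) auto
  then show thesis by (rule that)
qed

text \<open>Every realization gives the same closed form and some realization exists, so the
  definite description has this value.\<close>

lemma dihedral_angle_eq_dih:
  assumes dist: "distinct [i, j, k, l]"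
    and pos: "r i > 0" "r j > 0" "r k > 0" "r l > 0"
    and D: "disc (r i) (r j) (r k) (r l) > 0"
  shows "dihedral_angle r {i, j, k, l} i j = dih (r i) (r j) (r k) (r l)"
proof -
  have opp: "{i, j, k, l} - {i, j} = {k, l}" using dist by auto
  have val: "dihedral_of_points (p i) (p j) (p k) (p l) = dih (r i) (r j) (r k) (r l)"
    if "realizes p r {i, j, k, l}" for p
    using that pos unfolding realizes_insert4[OF dist]
    by (intro dihedral_of_points_eq_dih) auto
  obtain p where p: "realizes p r {i, j, k, l}"
    using realizes_exists[OF assms] .
  show ?thesis
    unfolding dihedral_angle_def
  proof (rule the_equality)
    show "\<exists>p k' l'. realizes p r {i, j, k, l} \<and> {i, j, k, l} - {i, j} = {k', l'} \<and> k' \<noteq> l' \<and>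
        dih (r i) (r j) (r k) (r l) = dihedral_of_points (p i) (p j) (p k') (p l')"
      using p val[OF p] opp dist by (intro exI[of _ p] exI[of _ k] exI[of _ l]) simp
  next
    fix \<beta>
    assume "\<exists>p k' l'. realizes p r {i, j, k, l} \<and> {i, j, k, l} - {i, j} = {k', l'} \<and> k' \<noteq> l' \<and>
        \<beta> = dihedral_of_points (p i) (p j) (p k') (p l')"
    then obtain p k' l' where p: "realizes p r {i, j, k, l}" and "{k, l} = {k', l'}"
      and \<beta>: "\<beta> = dihedral_of_points (p i) (p j) (p k') (p l')"
      unfolding opp by blast
    \<comment> \<open>The description leaves the order of the opposite vertices open; swapping them
      preserves the angle.\<close>
    then have "k' = k \<and> l' = l \<or> k' = l \<and> l' = k"
      by (auto simp: doubleton_eq_iff)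
    then show "\<beta> = dih (r i) (r j) (r k) (r l)"
      using \<beta> val[OF p] dihedral_of_points_commute by metis
  qed
qed

lemma tetra_volume_eq:
  assumes dist: "distinct [i, j, k, l]"
    and pos: "r i > 0" "r j > 0" "r k > 0" "r l > 0"
    and D: "disc (r i) (r j) (r k) (r l) > 0"
  shows "tetra_volume r {i, j, k, l} = sqrt (disc (r i) (r j) (r k) (r l)) / 3"
proof -
  have val: "measure lebesgue (convex hull (p ` {i, j, k, l})) = sqrt (disc (r i) (r j) (r k) (r l)) / 3"
    if "realizes p r {i, j, k, l}" for p
    using content_eq_sqrt_disc[OF pos, of "p i" "p j" "p k" "p l"] that
    unfolding realizes_insert4[OF dist] by simp
  obtain p where "realizes p r {i, j, k, l}"
    using realizes_exists[OF assms] .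
  then show ?thesis
    unfolding tetra_volume_def by (intro the_equality) (auto simp only: val intro: exI[of _ p])
qed

lemma solid_angle_eq_dih:
  assumes dist: "distinct [i, j, k, l]"
    and pos: "r i > 0" "r j > 0" "r k > 0" "r l > 0"
    and D: "disc (r i) (r j) (r k) (r l) > 0"
  shows "solid_angle r {i, j, k, l} i
    = dih (r i) (r j) (r k) (r l) + dih (r i) (r k) (r j) (r l) + dih (r i) (r l) (r j) (r k) - pi"
proof -
  have D': "disc (r i) (r k) (r j) (r l) > 0" "disc (r i) (r l) (r j) (r k) > 0"
    using D by (metis disc_commute)+
  have "dihedral_angle r {i, j, k, l} i k = dih (r i) (r k) (r j) (r l)"
    using dihedral_angle_eq_dih[of i k j l r] dist pos D' by (auto simp: insert_commute)
  moreover have "dihedral_angle r {i, j, k, l} i l = dih (r i) (r l) (r j) (r k)"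
    using dihedral_angle_eq_dih[of i l j k r] dist pos D' by (auto simp: insert_commute)
  moreover have "{i, j, k, l} - {i} = {j, k, l}" using dist by auto
  ultimately show ?thesis
    using dist dihedral_angle_eq_dih[OF assms] by (simp add: solid_angle_def)
qed

section \<open>Derivatives of solid angles\<close>

lemma DERIV_solid_angle:
  assumes dist: "distinct [i, j, k, l]"
    and deriv: "\<And>v. v \<in> {i, j, k, l} \<Longrightarrow> ((\<lambda>\<tau>. r \<tau> v) has_real_derivative r t v * x v) (at t within T)"
    and pos: "\<And>v. v \<in> {i, j, k, l} \<Longrightarrow> r t v > 0"
    and Q: "Q_form (r t) {i, j, k, l} > 0"
    and ev: "eventually (\<lambda>\<tau>. (\<forall>v\<in>{i, j, k, l}. r \<tau> v > 0) \<and> Q_form (r \<tau>) {i, j, k, l} > 0) (at t within T)"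
  shows "((\<lambda>\<tau>. solid_angle (r \<tau>) {i, j, k, l} i) has_real_derivative
     omega (r t i) (r t j) (r t k) (r t l) * (x j - x i)
     + omega (r t i) (r t k) (r t j) (r t l) * (x k - x i)
     + omega (r t i) (r t l) (r t j) (r t k) * (x l - x i)) (at t within T)"
proof -
  let ?A = "\<lambda>\<tau>. dih (r \<tau> i) (r \<tau> j) (r \<tau> k) (r \<tau> l) + dih (r \<tau> i) (r \<tau> k) (r \<tau> j) (r \<tau> l)
    + dih (r \<tau> i) (r \<tau> l) (r \<tau> j) (r \<tau> k)"
  have eq: "solid_angle (r \<tau>) {i, j, k, l} i = ?A \<tau> - pi"
    if "\<forall>v\<in>{i, j, k, l}. r \<tau> v > 0" "Q_form (r \<tau>) {i, j, k, l} > 0" for \<tau>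
    using solid_angle_eq_dih[OF dist, of "r \<tau>"] Q_form_pos_iff[OF dist, of "r \<tau>"] that by simp
  have D: "disc (r t i) (r t j) (r t k) (r t l) > 0"
    using Q Q_form_pos_iff[OF dist, of "r t"] pos by simp
  have "((\<lambda>\<tau>. ?A \<tau> - pi) has_real_derivative
     omega (r t i) (r t j) (r t k) (r t l) * (x j - x i)
     + omega (r t i) (r t k) (r t j) (r t l) * (x k - x i)
     + omega (r t i) (r t l) (r t j) (r t k) * (x l - x i) - 0) (at t within T)"
    by (intro DERIV_diff DERIV_const DERIV_dih_sum deriv pos D) auto
  \<comment> \<open>The closed form is established only for positive radii and positive
    \<open>Q_form\<close>; agreement near \<open>t\<close> and at \<open>t\<close> itself transfers
    the derivative.\<close>
  moreover have "eventually (\<lambda>\<tau>. ?A \<tau> - pi = solid_angle (r \<tau>) {i, j, k, l} i) (at t within T)"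
    using ev by eventually_elim (simp add: eq)
  moreover have "?A t - pi = solid_angle (r t) {i, j, k, l} i"
    using eq[of t] pos Q by simp
  ultimately show ?thesis
    by (simp add: has_field_derivative_cong_eventually)
qed

text \<open>Along the curve that moves only the radius at \<open>j\<close>, the logarithmic
  derivative is \<open>1 / r j\<close> at \<open>j\<close> and 0 elsewhere, so a single difference
  survives.\<close>

lemma DERIV_solid_angle_partial:
  assumes dist: "distinct [i, j, k, l]"
    and pos: "\<And>v. v \<in> {i, j, k, l} \<Longrightarrow> r v > 0"
    and Q: "Q_form r {i, j, k, l} > 0"
  shows "((\<lambda>x. solid_angle (r(j := x)) {i, j, k, l} i) has_real_derivative
     omega (r i) (r j) (r k) (r l) / r j) (at (r j))"
proof -
  have rj: "r j > 0" using pos by simp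
  have D: "disc (r i) (r j) (r k) (r l) > 0"
    using Q Q_form_pos_iff[OF dist, of r] pos by simp
  \<comment> \<open>Nondegeneracy is an open condition, as \<open>disc\<close> is a polynomial in
    the moving radius.\<close>
  have "continuous_on UNIV (\<lambda>x. disc (r i) x (r k) (r l))"
    unfolding disc_def by (intro continuous_intros)
  then have "isCont (\<lambda>x. disc (r i) x (r k) (r l)) (r j)"
    by (simp add: continuous_on_eq_continuous_at)
  then have "eventually (\<lambda>x. disc (r i) x (r k) (r l) > 0) (at (r j))"
    using D by (simp add: isCont_def order_tendstoD(1))
  moreover have "eventually (\<lambda>x. x > 0) (at (r j))"
    using rj order_tendstoD(1)[OF tendsto_ident_at] by blast
  ultimately have ev: "eventually (\<lambda>x. (\<forall>v\<in>{i, j, k, l}. (r(j := x)) v > 0) \<and>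
      Q_form (r(j := x)) {i, j, k, l} > 0) (at (r j))"
  proof eventually_elim
    case (elim x)
    then show ?case
      using dist pos Q_form_pos_iff[OF dist, of "r(j := x)"] by auto
  qed
  have "((\<lambda>x. (r(j := x)) v) has_real_derivative (r(j := r j)) v * (if j = v then 1 / r j else 0))
      (at (r j))" for v
    using rj by (cases "v = j") auto
  from DERIV_solid_angle[OF dist, of "\<lambda>x. r(j := x)", OF this _ _ ev]
  show ?thesis using dist pos Q by (simp add: eq_commute[of j i])
qed

lemma Omega_eq_omega:
  assumes dist: "distinct [i, j, k, l]"
    and pos: "\<And>v. v \<in> {i, j, k, l} \<Longrightarrow> r v > 0"
    and Q: "Q_form r {i, j, k, l} > 0"
  shows "Omega r {i, j, k, l} i j = omega (r i) (r j) (r k) (r l)"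
  using DERIV_imp_deriv[OF DERIV_solid_angle_partial[OF assms]] pos[of j]
  by (simp add: Omega_def)

lemma omega_eq_volume_formula:
  assumes dist: "distinct [i, j, k, l]"
    and pos: "\<And>v. v \<in> {i, j, k, l} \<Longrightarrow> r v > 0"
    and Q: "Q_form r {i, j, k, l} > 0"
  shows "omega (r i) (r j) (r k) (r l) =
     4 * r i * (r j)\<^sup>2 * (r k)\<^sup>2 * (r l)\<^sup>2
                / (3 * perimeter r i j k * perimeter r i j l * tetra_volume r {i, j, k, l})
              * (1 / r i * (1 / r j + 1 / r k + 1 / r l)
                 + 1 / r j * (1 / r i + 1 / r k + 1 / r l)
                 - (1 / r k - 1 / r l)\<^sup>2)"
proof -
  have D: "disc (r i) (r j) (r k) (r l) > 0"
    using Q Q_form_pos_iff[OF dist, of r] pos by simp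
  have "perimeter r i j k = 2 * (r i + r j + r k)" "perimeter r i j l = 2 * (r i + r j + r l)"
    by (simp_all add: perimeter_def edge_length_def)
  moreover have "tetra_volume r {i, j, k, l} = sqrt (disc (r i) (r j) (r k) (r l)) / 3"
    using tetra_volume_eq[OF dist _ _ _ _ D] pos by simp
  \<comment> \<open>The two perimeters give the factor 4, and the 3 cancels against the third in the
    volume.\<close>
  ultimately have "3 * perimeter r i j k * perimeter r i j l * tetra_volume r {i, j, k, l}
    = 4 * ((r i + r j + r k) * (r i + r j + r l) * sqrt (disc (r i) (r j) (r k) (r l)))"
    by (simp only:)
  then show ?thesis
    unfolding omega_def by (simp only: mult.assoc mult_divide_mult_cancel_left_if) simp
qed

text \<open>Version for a tetrahedron given as a set, summing over the vertices other than
  \<open>i\<close>. Positivity on \<open>T\<close> yields the eventual hypothesis of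
  \<open>DERIV_solid_angle\<close>, and positivity at \<open>t\<close> the pointwise ones.\<close>

lemma DERIV_solid_angle_Omega:
  assumes s: "card s = 4" "i \<in> s"
    and deriv: "\<And>v. v \<in> s \<Longrightarrow> ((\<lambda>\<tau>. r \<tau> v) has_real_derivative r t v * x v) (at t within T)"
    and pos: "\<And>\<tau> v. \<tau> \<in> insert t T \<Longrightarrow> v \<in> s \<Longrightarrow> r \<tau> v > 0"
    and Q: "\<And>\<tau>. \<tau> \<in> insert t T \<Longrightarrow> Q_form (r \<tau>) s > 0"
  shows "((\<lambda>\<tau>. solid_angle (r \<tau>) s i) has_real_derivative
     (\<Sum>j\<in>s - {i}. Omega (r t) s i j * (x j - x i))) (at t within T)"
proof -
  have "card (s - {i}) = 3" using s by simp
  then obtain j k l where jkl: "s - {i} = {j, k, l}" "j \<noteq> k" "k \<noteq> l" "j \<noteq> l"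
    by (auto simp: card_3_iff)
  then have dist: "distinct [i, j, k, l]" and seq: "s = {i, j, k, l}" using s(2) by auto
  \<comment> \<open>The other two edges at \<open>i\<close> are handled by relabelling the same
    vertex set.\<close>
  have perm: "{i, k, j, l} = {i, j, k, l}" "{i, l, j, k} = {i, j, k, l}" by auto
  have "Omega (r t) s i j = omega (r t i) (r t j) (r t k) (r t l)"
    unfolding seq using dist pos[of t] Q[of t] by (intro Omega_eq_omega) (auto simp: seq)
  moreover have "Omega (r t) s i k = omega (r t i) (r t k) (r t j) (r t l)"
    unfolding seq using dist pos[of t] Q[of t] Omega_eq_omega[of i k j l "r t"]
    by (auto simp: seq perm)
  moreover have "Omega (r t) s i l = omega (r t i) (r t l) (r t j) (r t k)"
    unfolding seq using dist pos[of t] Q[of t] Omega_eq_omega[of i l j k "r t"]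
    by (auto simp: seq perm)
  moreover have "((\<lambda>\<tau>. solid_angle (r \<tau>) {i, j, k, l} i) has_real_derivative
     omega (r t i) (r t j) (r t k) (r t l) * (x j - x i)
     + omega (r t i) (r t k) (r t j) (r t l) * (x k - x i)
     + omega (r t i) (r t l) (r t j) (r t k) * (x l - x i)) (at t within T)"
    using deriv pos Q unfolding seq
    by (intro DERIV_solid_angle dist) (auto simp: eventually_at_filter)
  ultimately show ?thesis
    using dist unfolding jkl(1) by (simp add: seq add.assoc)
qed

section \<open>Evolution of the curvature along the flow\<close>

theorem mainTheorem1:
  fixes S :: "'v set set" and T :: "real set" and r :: "real \<Rightarrow> 'v \<Rightarrow> real"
  assumes "finite_complex_dim3 S"
    and "is_interval T"
    and "\<And>t. t \<in> T \<Longrightarrow> metric_structure S (r t)"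
    and "\<And>t. t \<in> T \<Longrightarrow> nondegenerate S (r t)"
    and "yamabe_flow S T r"
  shows "(\<forall>t\<in>T. \<forall>i\<in>vertices S.
            ((\<lambda>\<tau>. curvature S (r \<tau>) i) has_real_derivative
               (\<Sum>s\<in>{s \<in> simplices S 3. i \<in> s}. \<Sum>j\<in>s - {i}.
                  Omega (r t) s i j * (curvature S (r t) j - curvature S (r t) i)))
              (at t within T))
       \<and> (\<forall>\<rho> i j k l. metric_structure S \<rho> \<and> nondegenerate S \<rho> \<and>
            distinct [i, j, k, l] \<and> {i, j, k, l} \<in> simplices S 3 \<longrightarrow>
            (\<lambda>x. solid_angle (\<rho>(j := x)) {i, j, k, l} i) differentiable at (\<rho> j) \<and>
            Omega \<rho> {i, j, k, l} i j =
              4 * \<rho> i * (\<rho> j)\<^sup>2 * (\<rho> k)\<^sup>2 * (\<rho> l)\<^sup>2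
                / (3 * perimeter \<rho> i j k * perimeter \<rho> i j l * tetra_volume \<rho> {i, j, k, l})
              * (1 / \<rho> i * (1 / \<rho> j + 1 / \<rho> k + 1 / \<rho> l)
                 + 1 / \<rho> j * (1 / \<rho> i + 1 / \<rho> k + 1 / \<rho> l)
                 - (1 / \<rho> k - 1 / \<rho> l)\<^sup>2))"
proof (intro conjI ballI allI impI)
  \<comment> \<open>Closure under faces makes each point of a tetrahedron a vertex, where positivity
    and the flow equation are available.\<close>
  have vert: "v \<in> vertices S" if "s \<in> simplices S 3" "v \<in> s" for s v
  proof -
    have "s \<in> S" using that by (simp add: simplices_def)
    then show ?thesis
      using assms(1) that(2)
      unfolding finite_complex_dim3_def finite_complex_def vertices_def by blast
  qed
  {
    fix t i assume t: "t \<in> T"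
    \<comment> \<open>The flow says that the logarithmic derivative of the radius at
      \<open>v\<close> is minus the curvature there.\<close>
    have "((\<lambda>\<tau>. solid_angle (r \<tau>) s i) has_real_derivative
        (\<Sum>j\<in>s - {i}. Omega (r t) s i j * (- curvature S (r t) j - - curvature S (r t) i)))
        (at t within T)"
      if "s \<in> {s \<in> simplices S 3. i \<in> s}" for s
    proof (rule DERIV_solid_angle_Omega)
      show "card s = 4" "i \<in> s" using that by (auto simp: simplices_def)
      show "((\<lambda>\<tau>. r \<tau> v) has_real_derivative r t v * - curvature S (r t) v) (at t within T)"
        if "v \<in> s" for v
        using assms(5) t vert[of s v] that \<open>s \<in> _\<close>
        unfolding yamabe_flow_def by (auto simp: mult.commute)
      show "r \<tau> v > 0" if "\<tau> \<in> insert t T" "v \<in> s" for \<tau> v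
        using assms(3) t vert[of s v] that \<open>s \<in> _\<close> unfolding metric_structure_def by auto
      show "Q_form (r \<tau>) s > 0" if "\<tau> \<in> insert t T" for \<tau>
        using assms(4) t that \<open>s \<in> _\<close> unfolding nondegenerate_def by auto
    qed
    then have "((\<lambda>\<tau>. curvature S (r \<tau>) i) has_real_derivative
      0 - (\<Sum>s\<in>{s \<in> simplices S 3. i \<in> s}. \<Sum>j\<in>s - {i}.
        Omega (r t) s i j * (- curvature S (r t) j - - curvature S (r t) i))) (at t within T)"
      unfolding curvature_def by (intro DERIV_diff DERIV_const DERIV_sum)
    \<comment> \<open>The sign from subtracting the solid angles cancels the sign of the
      flow.\<close>
    also have "0 - (\<Sum>s\<in>{s \<in> simplices S 3. i \<in> s}. \<Sum>j\<in>s - {i}.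
        Omega (r t) s i j * (- curvature S (r t) j - - curvature S (r t) i))
      = (\<Sum>s\<in>{s \<in> simplices S 3. i \<in> s}. \<Sum>j\<in>s - {i}.
        Omega (r t) s i j * (curvature S (r t) j - curvature S (r t) i))"
      unfolding diff_0 sum_negf[symmetric]
      by (intro sum.cong refl) (simp add: algebra_simps)
    finally show "((\<lambda>\<tau>. curvature S (r \<tau>) i) has_real_derivative
       (\<Sum>s\<in>{s \<in> simplices S 3. i \<in> s}. \<Sum>j\<in>s - {i}.
          Omega (r t) s i j * (curvature S (r t) j - curvature S (r t) i))) (at t within T)" .
  }
  fix \<rho> :: "'v \<Rightarrow> real" and i j k l
  assume "metric_structure S \<rho> \<and> nondegenerate S \<rho> \<and>
            distinct [i, j, k, l] \<and> {i, j, k, l} \<in> simplices S 3"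
  then have dist: "distinct [i, j, k, l]" and Q: "Q_form \<rho> {i, j, k, l} > 0"
    and pos: "\<And>v. v \<in> {i, j, k, l} \<Longrightarrow> \<rho> v > 0"
    using vert[of "{i, j, k, l}"] by (auto simp: nondegenerate_def metric_structure_def)
  show "(\<lambda>x. solid_angle (\<rho>(j := x)) {i, j, k, l} i) differentiable at (\<rho> j)"
    using DERIV_solid_angle_partial[OF dist pos Q] real_differentiable_def by blast
  show "Omega \<rho> {i, j, k, l} i j =
              4 * \<rho> i * (\<rho> j)\<^sup>2 * (\<rho> k)\<^sup>2 * (\<rho> l)\<^sup>2
                / (3 * perimeter \<rho> i j k * perimeter \<rho> i j l * tetra_volume \<rho> {i, j, k, l})
              * (1 / \<rho> i * (1 / \<rho> j + 1 / \<rho> k + 1 / \<rho> l)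
                 + 1 / \<rho> j * (1 / \<rho> i + 1 / \<rho> k + 1 / \<rho> l)
                 - (1 / \<rho> k - 1 / \<rho> l)\<^sup>2)"
    using Omega_eq_omega[OF dist pos Q] omega_eq_volume_formula[OF dist pos Q] by simp
qed

end
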